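(* Let $\lambda\in\mathbb Z$ and, for $t\ge0$ and $x\in\mathbb T^3$, set $$u^E(t,x)=\big(\sin(\lambda x_1+x_2-t\sin x_3),\ -\lambda\sin(\lambda x_1+x_2-t\sin x_3)+\sin x_3,\ 0\big).$$ Then $u^E$ is a global-in-time solution of the 3D Euler equations on $\mathbb T^3$ with smooth initial data $\big(\sin(\lambda x_1+x_2),\,-\lambda\sin(\lambda x_1+x_2)+\sin x_3,\,0\big)$, and, as $t\to\infty$, $u^E(t,\cdot)$ converges weakly in $L^2(\mathbb T^3)$ to the Kolmogorov flow $u^K=(0,\sin x_3,0)$, but does not converge strongly in $L^2(\mathbb T^3)$ to $u^K$.
   Context: $\mathbb T^3=(\mathbb R/2\pi\mathbb Z)^3$. The 3D Euler equations are $\partial_tu+u\cdot\nabla u+\nabla P=0$, $\operatorname{div}u=0$ on $\mathbb R_+\times\mathbb T^3$. *)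

theory Defs
  imports "HOL-Analysis.Analysis"
begin

text \<open>Functions on the torus are functions on \<open>real^3\<close> that are \<open>2\<pi>\<close>-periodic in each
  coordinate.\<close>

definition torus_periodic :: "(real^3 \<Rightarrow> 'b) \<Rightarrow> bool" where
  "torus_periodic f \<longleftrightarrow> (\<forall>i x. f (x + axis i (2 * pi)) = f x)"

definition torus_cell :: "(real^3) set" where
  "torus_cell = cbox 0 (\<chi> i. 2 * pi)"

text \<open>\<open>C\<^sup>n\<close> maps on the whole space, through iterated directional derivatives.\<close>

primrec Ck :: "nat \<Rightarrow> ('a::real_normed_vector \<Rightarrow> 'b::real_normed_vector) \<Rightarrow> bool" where
  "Ck 0 f \<longleftrightarrow> continuous_on UNIV f"
| "Ck (Suc n) f \<longleftrightarrow>
     (\<forall>x. f differentiable (at x)) \<and> (\<forall>v. Ck n (\<lambda>x. frechet_derivative f (at x) v))"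

definition smooth :: "('a::real_normed_vector \<Rightarrow> 'b::real_normed_vector) \<Rightarrow> bool" where
  "smooth f \<longleftrightarrow> (\<forall>n. Ck n f)"

text \<open>Vector calculus on \<open>real^3\<close>. In \<open>time_deriv\<close> the derivative is one-sided at \<open>t = 0\<close>.\<close>

definition partial_deriv :: "3 \<Rightarrow> (real^3 \<Rightarrow> 'b::real_normed_vector) \<Rightarrow> real^3 \<Rightarrow> 'b" where
  "partial_deriv i f x = frechet_derivative f (at x) (axis i 1)"

definition grad :: "(real^3 \<Rightarrow> real) \<Rightarrow> real^3 \<Rightarrow> real^3" where
  "grad p x = (\<chi> i. partial_deriv i p x)"

definition divergence :: "(real^3 \<Rightarrow> real^3) \<Rightarrow> real^3 \<Rightarrow> real" where
  "divergence v x = (\<Sum>i\<in>UNIV. partial_deriv i v x $ i)"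

definition advection :: "(real^3 \<Rightarrow> real^3) \<Rightarrow> (real^3 \<Rightarrow> real^3) \<Rightarrow> real^3 \<Rightarrow> real^3" where
  "advection v w x = (\<Sum>i\<in>UNIV. (v x $ i) *\<^sub>R partial_deriv i w x)"

definition time_deriv :: "(real \<Rightarrow> real^3 \<Rightarrow> real^3) \<Rightarrow> real \<Rightarrow> real^3 \<Rightarrow> real^3" where
  "time_deriv u t x = vector_derivative (\<lambda>s. u s x) (at t within {0..})"

text \<open>Regularity of classical solutions: \<open>C\<^sup>1\<close> jointly in time and space, up to \<open>t = 0\<close>.
  The values at negative times are irrelevant.\<close>

definition C1_spacetime :: "(real \<Rightarrow> real^3 \<Rightarrow> real^3) \<Rightarrow> bool" where
  "C1_spacetime u \<longleftrightarrow>
     (\<forall>t\<ge>0. \<forall>x. (\<lambda>s. u s x) differentiable (at t within {0..}) \<and> u t differentiable (at x)) \<and>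
     continuous_on ({0..} \<times> UNIV) (\<lambda>(t, x). u t x) \<and>
     continuous_on ({0..} \<times> UNIV) (\<lambda>(t, x). time_deriv u t x) \<and>
     (\<forall>i. continuous_on ({0..} \<times> UNIV) (\<lambda>(t, x). partial_deriv i (u t) x))"

definition global_euler_solution :: "(real \<Rightarrow> real^3 \<Rightarrow> real^3) \<Rightarrow> bool" where
  "global_euler_solution u \<longleftrightarrow>
     C1_spacetime u \<and> (\<forall>t\<ge>0. torus_periodic (u t)) \<and>
     (\<exists>P :: real \<Rightarrow> real^3 \<Rightarrow> real.
        (\<forall>t\<ge>0. torus_periodic (P t) \<and> (\<forall>x. P t differentiable (at x))) \<and>
        continuous_on ({0..} \<times> UNIV) (\<lambda>(t, x). grad (P t) x) \<and>
        (\<forall>t\<ge>0. \<forall>x. time_deriv u t x + advection (u t) (u t) x + grad (P t) x = 0 \<and>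
                   divergence (u t) x = 0))"

text \<open>\<open>L\<^sup>2\<close> vector fields on the torus, as representatives; the boundary of the cell is a null
  set.\<close>

definition L2_torus :: "(real^3 \<Rightarrow> real^3) set" where
  "L2_torus = {f. torus_periodic f \<and> f \<in> borel_measurable (lebesgue_on torus_cell) \<and>
                  integrable (lebesgue_on torus_cell) (\<lambda>x. (norm (f x))\<^sup>2)}"

definition L2_inner :: "(real^3 \<Rightarrow> real^3) \<Rightarrow> (real^3 \<Rightarrow> real^3) \<Rightarrow> real" where
  "L2_inner f g = (\<integral>x. f x \<bullet> g x \<partial>lebesgue_on torus_cell)"

definition L2_norm :: "(real^3 \<Rightarrow> real^3) \<Rightarrow> real" where
  "L2_norm f = sqrt (L2_inner f f)"

definition weakly_converges_L2 ::
    "('t \<Rightarrow> real^3 \<Rightarrow> real^3) \<Rightarrow> (real^3 \<Rightarrow> real^3) \<Rightarrow> 't filter \<Rightarrow> bool" where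
  "weakly_converges_L2 u v F \<longleftrightarrow>
     (\<forall>g\<in>L2_torus. ((\<lambda>t. L2_inner (u t) g) \<longlongrightarrow> L2_inner v g) F)"

definition strongly_converges_L2 ::
    "('t \<Rightarrow> real^3 \<Rightarrow> real^3) \<Rightarrow> (real^3 \<Rightarrow> real^3) \<Rightarrow> 't filter \<Rightarrow> bool" where
  "strongly_converges_L2 u v F \<longleftrightarrow> ((\<lambda>t. L2_norm (\<lambda>x. u t x - v x)) \<longlongrightarrow> 0) F"

definition uE :: "int \<Rightarrow> real \<Rightarrow> real^3 \<Rightarrow> real^3" where
  "uE l t x = vector
     [sin (of_int l * x$1 + x$2 - t * sin (x$3)),
      - of_int l * sin (of_int l * x$1 + x$2 - t * sin (x$3)) + sin (x$3),
      0]"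

definition uK :: "real^3 \<Rightarrow> real^3" where
  "uK x = vector [0, sin (x$3), 0]"

end

theory Submission
  imports Defs
begin

text \<open>Write \<open>\<theta> = \<lambda> x\<^sub>1 + x\<^sub>2 - t sin x\<^sub>3\<close>. Then \<open>u\<^sup>E - u\<^sup>K = sin \<theta> (1, -\<lambda>, 0)\<close>, the phase
  satisfies \<open>u\<^sup>E \<cdot> \<nabla>\<theta> = sin x\<^sub>3 = - \<partial>\<^sub>t\<theta>\<close>, and the Euler equations hold with zero pressure.
  A Riemann--Lebesgue lemma for \<open>cos (a x\<^sub>1 + b x\<^sub>2 + c - t sin x\<^sub>3)\<close> yields both convergence
  statements: weak convergence directly, and the failure of strong convergence because
  \<open>|u\<^sup>E - u\<^sup>K|\<^sup>2 = (1 + \<lambda>\<^sup>2) (1 - cos 2\<theta>) / 2\<close>, where the integral of \<open>cos 2\<theta>\<close> tends to zero.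
  For the Riemann--Lebesgue lemma, density reduces the test functions to indicators of boxes,
  where the integral factorises and only the oscillation in \<open>x\<^sub>3\<close> matters.\<close>

section \<open>A Riemann--Lebesgue lemma\<close>

lemma integrable_mult_bounded:
  fixes h f :: "'a \<Rightarrow> real"
  assumes "integrable M h" "f \<in> borel_measurable M" "\<And>x. \<bar>f x\<bar> \<le> 1"
  shows "integrable M (\<lambda>x. h x * f x)"
proof (rule Bochner_Integration.integrable_bound[OF assms(1)])
  show "(\<lambda>x. h x * f x) \<in> borel_measurable M" using assms by measurable
  show "AE x in M. norm (h x * f x) \<le> norm (h x)"
    using assms(3) by (auto simp: abs_mult intro!: mult_left_le)
qed

text \<open>Because the oscillating factor is bounded by 1, replacing \<open>h\<close> by
  \<open>s n\<close> changes the integral by at most their L1 distance, uniformly in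
  \<open>t\<close>. Dominated convergence makes this distance small for some fixed \<open>n\<close>,
  and only then does \<open>t\<close> move. No rate uniform in \<open>n\<close> is required, which
  the one-dimensional estimate below relies on.\<close>

lemma tendsto_integral_zero_dominated_closure:
  fixes \<phi> :: "'t \<Rightarrow> 'a \<Rightarrow> real"
  assumes \<phi>: "\<And>t. \<phi> t \<in> borel_measurable M" "\<And>t x. \<bar>\<phi> t x\<bar> \<le> 1"
    and s: "\<And>n. integrable M (s n)" "AE x in M. (\<lambda>n. s n x) \<longlonglongrightarrow> h x"
      "\<And>n. AE x in M. \<bar>s n x\<bar> \<le> w x" "integrable M w"
    and h: "h \<in> borel_measurable M"
    and lim: "\<And>n. ((\<lambda>t. \<integral>x. s n x * \<phi> t x \<partial>M) \<longlongrightarrow> 0) F"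
  shows "((\<lambda>t. \<integral>x. h x * \<phi> t x \<partial>M) \<longlongrightarrow> 0) F"
proof (rule tendstoI)
  fix \<epsilon> :: real assume \<epsilon>: "\<epsilon> > 0"
  have h_int: "integrable M h"
    using integrable_dominated_convergence[OF h _ s(4,2)] s(1,3) by (auto dest: borel_measurable_integrable)
  have "(\<lambda>n. \<integral>x. \<bar>h x - s n x\<bar> \<partial>M) \<longlonglongrightarrow> (\<integral>x. 0 \<partial>M)"
  proof (rule integral_dominated_convergence[where w="\<lambda>x. \<bar>h x\<bar> + w x"])
    show "integrable M (\<lambda>x. \<bar>h x\<bar> + w x)" using h_int s(4) by auto
    show "AE x in M. (\<lambda>n. \<bar>h x - s n x\<bar>) \<longlonglongrightarrow> 0"
      using s(2)
    proof eventually_elim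
      case (elim x)
      then have "(\<lambda>n. \<bar>h x - s n x\<bar>) \<longlonglongrightarrow> \<bar>h x - h x\<bar>" by (intro tendsto_intros)
      then show ?case by simp
    qed
    show "AE x in M. norm \<bar>h x - s n x\<bar> \<le> \<bar>h x\<bar> + w x" for n
      using s(3)[of n] by eventually_elim auto
  qed (use h s(1) in \<open>auto dest: borel_measurable_integrable\<close>)
  then have "\<forall>\<^sub>F n in sequentially. (\<integral>x. \<bar>h x - s n x\<bar> \<partial>M) < \<epsilon> / 2"
    using \<epsilon> by (auto dest!: order_tendstoD(2)[where a="\<epsilon>/2"])
  then obtain n where n: "(\<integral>x. \<bar>h x - s n x\<bar> \<partial>M) < \<epsilon> / 2"
    by (auto simp: eventually_sequentially)
  have "\<forall>\<^sub>F t in F. \<bar>\<integral>x. s n x * \<phi> t x \<partial>M\<bar> < \<epsilon> / 2"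
    using tendstoD[OF lim[of n], of "\<epsilon>/2"] \<epsilon> by (simp add: dist_real_def)
  then show "\<forall>\<^sub>F t in F. dist (\<integral>x. h x * \<phi> t x \<partial>M) 0 < \<epsilon>"
  proof eventually_elim
    case (elim t)
    have i: "integrable M (\<lambda>x. s n x * \<phi> t x)" "integrable M (\<lambda>x. (h x - s n x) * \<phi> t x)"
      using s(1) h_int \<phi> by (auto intro!: integrable_mult_bounded)
    have "(\<integral>x. h x * \<phi> t x \<partial>M) = (\<integral>x. s n x * \<phi> t x + (h x - s n x) * \<phi> t x \<partial>M)"
      by (simp add: algebra_simps)
    also have "\<dots> = (\<integral>x. s n x * \<phi> t x \<partial>M) + (\<integral>x. (h x - s n x) * \<phi> t x \<partial>M)"
      using i by simp
    finally have eq: "(\<integral>x. h x * \<phi> t x \<partial>M) = \<dots>" .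
    have "\<bar>\<integral>x. (h x - s n x) * \<phi> t x \<partial>M\<bar> \<le> (\<integral>x. \<bar>(h x - s n x) * \<phi> t x\<bar> \<partial>M)"
      by (rule integral_abs_bound)
    also have "\<dots> \<le> (\<integral>x. \<bar>h x - s n x\<bar> \<partial>M)"
      using h_int s(1) \<phi>(2)
      by (intro integral_mono integrable_abs i) (auto simp: abs_mult intro!: mult_left_le)
    finally show ?case using eq elim n by (simp add: dist_real_def)
  qed
qed

text \<open>The class of admissible test functions grows in three stages: Borel subsets of a fixed
  box by a Dynkin argument (boxes are stable under intersection), then Borel sets of finite measure
  by exhaustion, then integrable functions by \<open>integrable_induct\<close>. Each passage to a
  limit is an instance of the closure lemma.\<close>

lemma tendsto_integral_zero_from_boxes:
  fixes \<phi> :: "'t \<Rightarrow> 'a::euclidean_space \<Rightarrow> real"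
  assumes \<phi>: "\<And>t. \<phi> t \<in> borel_measurable borel" "\<And>t x. \<bar>\<phi> t x\<bar> \<le> 1"
    and box: "\<And>a b. ((\<lambda>t. \<integral>x. indicator (box a b) x * \<phi> t x \<partial>lborel) \<longlongrightarrow> 0) F"
    and h: "integrable lborel h"
  shows "((\<lambda>t. \<integral>x. h x * \<phi> t x \<partial>lborel) \<longlongrightarrow> 0) F"
proof -
  have \<phi>': "\<And>t. \<phi> t \<in> borel_measurable lborel" using \<phi> by simp
  note closure = tendsto_integral_zero_dominated_closure[OF \<phi>' \<phi>(2)]
  have box_int: "integrable lborel (indicator (A \<inter> box a b) :: 'a \<Rightarrow> real)"
    if "A \<in> sets borel" for A a b
  proof -
    have "emeasure lborel (A \<inter> box a b) \<le> emeasure lborel (box a b)"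
      using that by (intro emeasure_mono) auto
    also have "\<dots> < \<infinity>" using emeasure_lborel_box_finite by (simp add: less_top)
    finally show ?thesis using that by simp
  qed
  \<comment> \<open>Cutting with a fixed box keeps all measures finite: a complement becomes a
    difference of integrable indicators, and countable unions have the indicator of the box as a
    common dominating function.\<close>
  have P: "((\<lambda>t. \<integral>x. indicator (A \<inter> box a b) x * \<phi> t x \<partial>lborel) \<longlongrightarrow> 0) F"
    if "A \<in> sets borel" for A :: "'a set" and a b
  proof -
    let ?G = "range (\<lambda>(a, b). box a b::'a set)"
    have sb: "sigma_sets UNIV ?G = sets borel" by (simp add: borel_eq_box)
    have "Int_stable ?G" by (auto simp: Int_stable_def box_Int_box)
    moreover have "?G \<subseteq> Pow UNIV" by simp
    moreover have "A \<in> sigma_sets UNIV ?G" using that sb by simp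
    ultimately show ?thesis
    proof (induction rule: sigma_sets_induct_disjoint)
      case (basic A)
      then show ?case using box by (auto simp: box_Int_box)
    next
      case empty
      then show ?case by simp
    next
      case (compl A)
      have A: "A \<in> sets borel" using compl sb by simp
      have "(\<integral>x. indicator ((UNIV - A) \<inter> box a b) x * \<phi> t x \<partial>lborel) =
        (\<integral>x. indicator (box a b) x * \<phi> t x \<partial>lborel) -
        (\<integral>x. indicator (A \<inter> box a b) x * \<phi> t x \<partial>lborel)" for t
      proof -
        have "(\<integral>x. indicator ((UNIV - A) \<inter> box a b) x * \<phi> t x \<partial>lborel) =
          (\<integral>x. indicator (box a b) x * \<phi> t x - indicator (A \<inter> box a b) x * \<phi> t x \<partial>lborel)"
          by (intro Bochner_Integration.integral_cong) (auto split: split_indicator)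
        then show ?thesis
          using box_int[of UNIV a b] box_int[OF A, of a b] \<phi>
          by (simp add: integrable_mult_bounded)
      qed
      then show ?case using tendsto_diff[OF box[of a b] compl.IH] by simp
    next
      case (union A)
      have A: "A i \<in> sets borel" for i using union.hyps(2) sb by blast
      let ?s = "\<lambda>n x. \<Sum>i<n. indicator (A i \<inter> box a b) x :: real"
      \<comment> \<open>Disjointness makes each partial sum an indicator again, hence bounded by the
        indicator of the box.\<close>
      have s: "?s n = indicator ((\<Union>i<n. A i) \<inter> box a b)" for n
      proof
        fix x
        have "indicator (\<Union>i<n. A i \<inter> box a b) x = ?s n x"
          using union.hyps(1)
          by (intro indicator_UN_disjoint) (auto simp: disjoint_family_on_def)
        then show "?s n x = indicator ((\<Union>i<n. A i) \<inter> box a b) x"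
          by (simp add: Int_UN_distrib2)
      qed
      show ?case
      proof (rule closure[where s="?s" and w="indicator (box a b)"])
        show "integrable lborel (?s n)" for n using A by (auto intro!: Bochner_Integration.integrable_sum box_int)
        show "AE x in lborel. (\<lambda>n. ?s n x) \<longlonglongrightarrow> indicator (\<Union> (range A) \<inter> box a b) x"
        proof (rule AE_I2)
          fix x
          have "(\<lambda>n. indicator (\<Union>i<n. A i \<inter> box a b) x :: real) \<longlonglongrightarrow> indicator (\<Union>i. A i \<inter> box a b) x"
            by (rule LIMSEQ_indicator_UN)
          then show "(\<lambda>n. ?s n x) \<longlonglongrightarrow> indicator (\<Union> (range A) \<inter> box a b) x"
            by (simp add: fun_cong[OF s] Int_UN_distrib2)
        qed
        show "AE x in lborel. \<bar>?s n x\<bar> \<le> indicator (box a b) x" for n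
          by (simp add: fun_cong[OF s] split: split_indicator)
        show "integrable lborel (indicator (box a b) :: 'a \<Rightarrow> real)" using box_int[of UNIV a b] by simp
        show "indicator (\<Union> (range A) \<inter> box a b) \<in> borel_measurable lborel" using A by simp
        show "((\<lambda>t. \<integral>x. ?s n x * \<phi> t x \<partial>lborel) \<longlongrightarrow> 0) F" for n
        proof -
          have "(\<integral>x. ?s n x * \<phi> t x \<partial>lborel) =
            (\<Sum>i<n. \<integral>x. indicator (A i \<inter> box a b) x * \<phi> t x \<partial>lborel)" for t
            unfolding sum_distrib_right
            using A \<phi> by (intro Bochner_Integration.integral_sum integrable_mult_bounded box_int) auto
          then show ?thesis using union.IH by (auto intro!: tendsto_null_sum)
        qed
      qed
    qed
  qed
  show ?thesis
    using h
  proof (induction rule: integrable_induct)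
    case (base A c)
    \<comment> \<open>Growing cubes exhaust the space; \<open>x\<close> lies in all of them from any
      index above its norm onwards.\<close>
    let ?B = "\<lambda>n::nat. box (- (real n *\<^sub>R One)) (real n *\<^sub>R One) :: 'a set"
    let ?s = "\<lambda>n x. indicator (A \<inter> ?B n) x :: real"
    have A: "A \<in> sets borel" using base by simp
    have "((\<lambda>t. \<integral>x. indicator A x * \<phi> t x \<partial>lborel) \<longlongrightarrow> 0) F"
    proof (rule closure[where s="?s" and w="indicator A"])
      show "integrable lborel (?s n)" for n using box_int[OF A] .
      show "AE x in lborel. (\<lambda>n. ?s n x) \<longlonglongrightarrow> indicator A x"
      proof (rule AE_I2)
        fix x :: 'a
        obtain N :: nat where N: "real N > norm x" using reals_Archimedean2 by blast
        have "x \<in> ?B n" if "n \<ge> N" for n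
        proof -
          have "\<bar>x \<bullet> i\<bar> < real n" if i: "i \<in> Basis" for i
            using Basis_le_norm[OF i, of x] N \<open>n \<ge> N\<close> by linarith
          then show ?thesis by (fastforce simp: mem_box)
        qed
        then have "\<forall>\<^sub>F n in sequentially. ?s n x = indicator A x"
          unfolding eventually_sequentially by (auto simp: indicator_def)
        then show "(\<lambda>n. ?s n x) \<longlonglongrightarrow> indicator A x" by (rule tendsto_eventually)
      qed
      show "AE x in lborel. \<bar>?s n x\<bar> \<le> indicator A x" for n by (auto split: split_indicator)
      show "integrable lborel (indicator A :: 'a \<Rightarrow> real)" using base by simp
      show "indicator A \<in> borel_measurable lborel" using A by simp
      show "((\<lambda>t. \<integral>x. ?s n x * \<phi> t x \<partial>lborel) \<longlongrightarrow> 0) F" for n using P[OF A] .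
    qed
    from tendsto_mult_left_zero[OF this, of c] show ?case
      by (simp add: mult.assoc mult.commute mult.left_commute)
  next
    case (add f g)
    have "(\<integral>x. (f x + g x) * \<phi> t x \<partial>lborel) =
      (\<integral>x. f x * \<phi> t x \<partial>lborel) + (\<integral>x. g x * \<phi> t x \<partial>lborel)" for t
      using add \<phi> by (simp add: distrib_right integrable_mult_bounded)
    then show ?case using tendsto_add[OF add.IH] by simp
  next
    case (lim f s)
    show ?case
      \<comment> \<open>The domination by twice the absolute value of \<open>f\<close> is supplied
        by the limit case of \<open>integrable_induct\<close>.\<close>
      by (rule closure[where s=s and w="\<lambda>x. 2 * \<bar>f x\<bar>"]) (use lim in auto)
  qed
qed

section \<open>Product integrals and the one-dimensional oscillation\<close>

lemma integral_lborel_prod: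
  fixes f :: "'a::euclidean_space \<Rightarrow> real \<Rightarrow> real"
  assumes "\<And>b. b \<in> Basis \<Longrightarrow> integrable lborel (f b)"
  shows "(\<integral>x. (\<Prod>b\<in>Basis. f b (x \<bullet> b)) \<partial>lborel) = (\<Prod>b\<in>Basis. \<integral>x. f b x \<partial>lborel)"
proof -
  interpret product_sigma_finite "\<lambda>_::'a. lborel :: real measure" ..
  have [measurable]: "f b \<in> borel_measurable borel" if "b \<in> Basis" for b
    using assms[OF that] by auto
  have "(\<integral>x. (\<Prod>b\<in>Basis. f b (x \<bullet> b)) \<partial>lborel) =
    (\<integral>y. (\<Prod>b\<in>Basis. f b ((\<Sum>c\<in>Basis. y c *\<^sub>R c) \<bullet> b)) \<partial>(\<Pi>\<^sub>M b\<in>(Basis::'a set). lborel))"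
    \<comment> \<open>Lebesgue measure is the image of the product measure under recombining
      coordinates, so the claim becomes Fubini for a product of one-variable functions.\<close>
    by (subst lborel_eq, subst integral_distr) auto
  also have "\<dots> = (\<integral>y. (\<Prod>b\<in>Basis. f b (y b)) \<partial>(\<Pi>\<^sub>M b\<in>(Basis::'a set). lborel))"
    by (intro Bochner_Integration.integral_cong prod.cong refl)
       (auto simp: inner_sum_left inner_Basis if_distrib sum.delta cong: if_cong)
  also have "\<dots> = (\<Prod>b\<in>Basis. \<integral>x. f b x \<partial>lborel)"
    by (rule product_integral_prod) (use assms in auto)
  finally show ?thesis .
qed

lemma integral_real3_prod:
  fixes f1 f2 f3 :: "real \<Rightarrow> real"
  assumes "integrable lborel f1" "integrable lborel f2" "integrable lborel f3"
  shows "(\<integral>x. f1 ((x::real^3)$1) * f2 (x$2) * f3 (x$3) \<partial>lborel) =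
    (\<integral>x. f1 x \<partial>lborel) * (\<integral>x. f2 x \<partial>lborel) * (\<integral>x. f3 x \<partial>lborel)"
proof -
  have B: "(Basis :: (real^3) set) = {axis 1 1, axis 2 1, axis 3 1}"
    by (auto simp: Basis_vec_def UNIV_3)
  have d: "axis 1 1 \<noteq> (axis 2 1::real^3)" "axis 1 1 \<noteq> (axis 3 1::real^3)" "axis 2 1 \<noteq> (axis 3 1::real^3)"
    by (auto simp: axis_eq_axis)
  define f where "f b = (if b = axis 1 1 then f1 else if b = axis 2 1 then f2 else f3)" for b :: "real^3"
  have fs: "f (axis 1 1) = f1" "f (axis 2 1) = f2" "f (axis 3 1) = f3"
    using d by (auto simp: f_def)
  have "integrable lborel (f b)" for b using assms by (auto simp: f_def)
  from integral_lborel_prod[of f, OF this] show ?thesis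
    using d by (simp add: B fs inner_axis mult.assoc)
qed

text \<open>The phase \<open>sin x\<close> is stationary where \<open>cos x = 0\<close>. The weight
  \<open>cos\<^sup>2 x / (cos\<^sup>2 x + 1/(n+1))\<close> vanishes there, so that one may integrate by parts
  against it, and it increases to \<open>1\<close> almost everywhere.\<close>

lemma tendsto_integral_cos_sin:
  fixes a b c :: real
  shows "((\<lambda>t. \<integral>x. indicator {a<..<b} x * cos (c - t * sin x) \<partial>lborel) \<longlongrightarrow> 0) at_top"
proof (cases "a \<le> b")
  case False
  then show ?thesis by simp
next
  case ab: True
  \<comment> \<open>The weight is split as \<open>q n x * cos x\<close>: the factor
    \<open>cos x\<close> combines with the oscillation into an exact derivative, and
    \<open>q n\<close> stays smooth since \<open>1 / real (Suc n)\<close> keeps its denominator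
    positive.\<close>
  define q where "q n x = cos x / ((cos x)\<^sup>2 + 1 / real (Suc n))" for n x
  define dq where "dq n x = (- sin x * ((cos x)\<^sup>2 + 1 / real (Suc n)) - cos x * (2 * cos x * (- sin x)))
     / ((cos x)\<^sup>2 + 1 / real (Suc n))\<^sup>2" for n x
  have pos: "(cos x)\<^sup>2 + 1 / real (Suc n) > 0" for n x
    by (simp add: add_nonneg_pos)
  have dq: "(q n has_real_derivative dq n x) (at x)" for n x
    unfolding q_def dq_def using pos[of x n]
    by (auto intro!: derivative_eq_intros simp: power2_eq_square)
  have cq: "continuous_on S (q n)" "continuous_on S (dq n)" for S n
    unfolding q_def dq_def using pos[of _ n]
    by (auto intro!: continuous_intros simp: less_imp_neq[symmetric] simp del: of_nat_Suc) 
  have qcos: "0 \<le> q n x * cos x" "q n x * cos x \<le> 1" for n x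
    using pos[of x n] by (auto simp: q_def power2_eq_square divide_le_eq)
  let ?s = "\<lambda>n x. indicator {a..b} x * (q n x * cos x)"
  have \<phi>: "(\<lambda>x. cos (c - t * sin x)) \<in> borel_measurable lborel" for t by measurable
  \<comment> \<open>At zeros of the cosine the weights stay 0 instead of tending to 1. The endpoints
    are excluded because integration by parts works on the closed interval while the claim is about
    the open one.\<close>
  have nz: "AE x in lborel. cos x \<noteq> 0 \<and> x \<noteq> a \<and> x \<noteq> b"
  proof -
    have "{x. cos x = 0} \<subseteq> range (\<lambda>i::int. of_int i * pi + pi / 2)"
      unfolding cos_zero_iff_int2 by auto
    then have "countable {x::real. cos x = 0}" by (rule countable_subset) simp
    then have "countable ({x::real. cos x = 0} \<union> {a, b})" by simp
    then have "{x. cos x = 0} \<union> {a, b} \<in> null_sets lborel" by (rule countable_imp_null_set_lborel)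
    from AE_not_in[OF this] show ?thesis by eventually_elim auto
  qed
  show ?thesis
  proof (rule tendsto_integral_zero_dominated_closure[where s="?s" and w="indicator {a..b}", OF \<phi>])
    show "\<bar>cos (c - t * sin x)\<bar> \<le> 1" for t x by simp
    show "integrable lborel (?s n)" for n
      using borel_integrable_atLeastAtMost'[of a b "\<lambda>x. q n x * cos x"]
        continuous_on_mult[OF cq(1)[of "{a..b}" n] continuous_on_cos[OF continuous_on_id]]
      by (simp add: set_integrable_def)
    show "AE x in lborel. (\<lambda>n. ?s n x) \<longlonglongrightarrow> indicator {a<..<b} x"
      using nz
    proof eventually_elim
      case (elim x)
      have "(\<lambda>n. (cos x)\<^sup>2 + 1 / real (Suc n)) \<longlonglongrightarrow> (cos x)\<^sup>2 + 0"
        using LIMSEQ_inverse_real_of_nat by (intro tendsto_intros) (simp add: inverse_eq_divide)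
      then have "(\<lambda>n. q n x * cos x) \<longlonglongrightarrow> cos x / ((cos x)\<^sup>2 + 0) * cos x"
        unfolding q_def
        by (rule tendsto_mult[OF tendsto_divide[OF tendsto_const] tendsto_const]) (use elim in simp)
      then have "(\<lambda>n. q n x * cos x) \<longlonglongrightarrow> 1" using elim by (simp add: power2_eq_square)
      then have "(\<lambda>n. ?s n x) \<longlonglongrightarrow> indicator {a..b} x * 1" by (intro tendsto_intros)
      then show ?case using elim by (auto simp: indicator_def split: if_splits)
    qed
    show "AE x in lborel. \<bar>?s n x\<bar> \<le> indicator {a..b} x" for n
      using qcos by (auto split: split_indicator)
    show "integrable lborel (indicator {a..b} :: real \<Rightarrow> real)"
      by (rule integrable_real_indicator) (use ab in auto)
    show "indicator {a<..<b} \<in> borel_measurable lborel" by simp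
    fix n
    have di: "integrable lborel (\<lambda>x. indicator {a..b} x * dq n x)"
      using borel_integrable_atLeastAtMost'[of a b "dq n"] cq
      by (auto simp: set_integrable_def)
    \<comment> \<open>Boundary terms plus the L1 norm of the derivative of \<open>q n\<close> on the
      interval: independent of \<open>t\<close>, though it may depend on \<open>n\<close>.\<close>
    define K where "K = \<bar>q n b\<bar> + \<bar>q n a\<bar> + (\<integral>x. \<bar>indicator {a..b} x * dq n x\<bar> \<partial>lborel)"
    have K: "\<bar>\<integral>x. ?s n x * cos (c - t * sin x) \<partial>lborel\<bar> \<le> K * inverse t" if t: "t > 0" for t
    proof -
      \<comment> \<open>The antiderivative of \<open>?g\<close> gains a factor \<open>1/t\<close>,
        the source of all the decay.\<close>
      let ?G = "\<lambda>x. - sin (c - t * sin x) / t"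
      let ?g = "\<lambda>x. cos (c - t * sin x) * cos x"
      have G: "(?G has_real_derivative ?g x) (at x)" for x
        using t by (auto intro!: derivative_eq_intros)
      have Gb: "\<bar>?G x\<bar> \<le> inverse t" for x
        using t by (simp add: divide_inverse abs_mult mult_left_le_one_le)
      have "(\<integral>x. ?s n x * cos (c - t * sin x) \<partial>lborel) = (\<integral>x. (q n x * ?g x) * indicator {a..b} x \<partial>lborel)"
        by (intro Bochner_Integration.integral_cong) auto
      also have "\<dots> = q n b * ?G b - q n a * ?G a - (\<integral>x. (dq n x * ?G x) * indicator {a..b} x \<partial>lborel)"
      proof (rule integral_by_parts[OF ab])
        show "isCont (dq n) x" for x using cq(2)[of UNIV n] by (simp add: continuous_on_eq_continuous_at)
        show "isCont ?g x" for x by (intro continuous_intros)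
      qed (use dq G in auto)
      finally have eq: "(\<integral>x. ?s n x * cos (c - t * sin x) \<partial>lborel) = \<dots>" .
      have "\<bar>\<integral>x. (dq n x * ?G x) * indicator {a..b} x \<partial>lborel\<bar> \<le>
        (\<integral>x. \<bar>indicator {a..b} x * dq n x\<bar> * inverse t \<partial>lborel)"
      proof (rule order_trans[OF integral_abs_bound], rule integral_mono)
        show "integrable lborel (\<lambda>x. \<bar>indicator {a..b} x * dq n x\<bar> * inverse t)" using di by auto
        have "integrable lborel (\<lambda>x. indicator {a..b} x *\<^sub>R (dq n x * ?G x))"
          unfolding set_integrable_def[symmetric]
          using cq(2)[of "{a..b}" n] t by (intro borel_integrable_atLeastAtMost') (auto intro!: continuous_intros)
        then have "integrable lborel (\<lambda>x. (dq n x * ?G x) * indicator {a..b} x)"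
          by (simp add: mult.commute)
        then show "integrable lborel (\<lambda>x. \<bar>(dq n x * ?G x) * indicator {a..b} x\<bar>)"
          by (rule integrable_abs)
        show "\<bar>(dq n x * ?G x) * indicator {a..b} x\<bar> \<le> \<bar>indicator {a..b} x * dq n x\<bar> * inverse t" for x
          using mult_left_mono[OF Gb[of x], of "\<bar>dq n x\<bar>"] by (auto simp: abs_mult split: split_indicator)
      qed
      also have "\<dots> = (\<integral>x. \<bar>indicator {a..b} x * dq n x\<bar> \<partial>lborel) * inverse t" by simp
      finally have 1: "\<bar>\<integral>x. (dq n x * ?G x) * indicator {a..b} x \<partial>lborel\<bar> \<le> \<dots>" .
      have 2: "\<bar>q n x * ?G x\<bar> \<le> \<bar>q n x\<bar> * inverse t" for x
        unfolding abs_mult using Gb by (intro mult_left_mono) auto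
      show ?thesis unfolding eq K_def
        using 1 2[of a] 2[of b] unfolding distrib_right by linarith
    qed
    have "((\<lambda>t. K * inverse t) \<longlongrightarrow> K * 0) at_top"
      by (intro tendsto_intros tendsto_inverse_0_at_top filterlim_ident)
    then have "((\<lambda>t. K * inverse t) \<longlongrightarrow> 0) at_top" by simp
    then show "((\<lambda>t. \<integral>x. ?s n x * cos (c - t * sin x) \<partial>lborel) \<longlongrightarrow> 0) at_top"
      by (rule Lim_null_comparison[rotated])
         (use K in \<open>auto intro!: eventually_mono[OF eventually_gt_at_top[of 0]]\<close>)
  qed
qed

section \<open>The oscillation on boxes and on the torus cell\<close>

definition osc :: "real \<Rightarrow> real \<Rightarrow> real \<Rightarrow> real \<Rightarrow> real^3 \<Rightarrow> real" where
  "osc a b c t x = cos (a * x$1 + b * x$2 + c - t * sin (x$3))"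

lemma osc_measurable [measurable]: "osc a b c t \<in> borel_measurable borel"
  unfolding osc_def by measurable

text \<open>The addition formulas split \<open>osc\<close> into four products of one-variable
  functions, as does the indicator of the box. In each product only the third factor depends on
  \<open>t\<close>, and its integral tends to 0.\<close>

lemma tendsto_integral_osc_box:
  "((\<lambda>t. \<integral>x. indicator (box u v) x * osc a b c t x \<partial>lborel) \<longlongrightarrow> 0) at_top"
proof -
  define I where "I i = (indicator {u$i<..<v$i} :: real \<Rightarrow> real)" for i
  have I: "integrable lborel (I i)" for i
    unfolding I_def by (cases "u$i \<le> v$i") auto
  have box: "indicator (box u v) x = I 1 (x$1) * I 2 (x$2) * I 3 (x$3)" for x
    by (auto simp: I_def mem_box_cart forall_3 split: split_indicator)
  have Im: "integrable lborel (\<lambda>x. I i x * f x)"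
    if "f \<in> borel_measurable borel" "\<And>x. \<bar>f x\<bar> \<le> 1" for i f
    using that by (intro integrable_mult_bounded[OF I]) auto
  let ?p = "\<lambda>f1 f2 c t (x::real^3). (I 1 (x$1) * f1 (x$1)) * (I 2 (x$2) * f2 (x$2)) * (I 3 (x$3) * cos (c - t * sin (x$3)))"
  have p_int: "(\<integral>x. ?p f1 f2 c t x \<partial>lborel) =
      (\<integral>x. I 1 x * f1 x \<partial>lborel) * (\<integral>x. I 2 x * f2 x \<partial>lborel) * (\<integral>x. I 3 x * cos (c - t * sin x) \<partial>lborel)"
    if "f1 \<in> borel_measurable borel" "\<And>x. \<bar>f1 x\<bar> \<le> 1" "f2 \<in> borel_measurable borel" "\<And>x. \<bar>f2 x\<bar> \<le> 1"
    for f1 f2 c t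
    by (rule integral_real3_prod[of "\<lambda>x. I 1 x * f1 x" "\<lambda>x. I 2 x * f2 x" "\<lambda>x. I 3 x * cos (c - t * sin x)"])
       (use that in \<open>auto intro!: Im\<close>)
  have p_lim: "((\<lambda>t. \<integral>x. ?p f1 f2 c t x \<partial>lborel) \<longlongrightarrow> 0) at_top"
    if "f1 \<in> borel_measurable borel" "\<And>x. \<bar>f1 x\<bar> \<le> 1" "f2 \<in> borel_measurable borel" "\<And>x. \<bar>f2 x\<bar> \<le> 1"
    for f1 f2 c
    unfolding p_int[OF that]
    using tendsto_integral_cos_sin[of "u$3" "v$3" c]
    unfolding I_def by (rule tendsto_mult_right_zero)
  have p_integrable: "integrable lborel (?p f1 f2 c t)"
    if "f1 \<in> borel_measurable borel" "\<And>x. \<bar>f1 x\<bar> \<le> 1" "f2 \<in> borel_measurable borel" "\<And>x. \<bar>f2 x\<bar> \<le> 1"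
    for f1 f2 c t
  proof -
    have "integrable lborel (indicator (box u v) :: real^3 \<Rightarrow> real)"
      by (rule integrable_real_indicator) (use emeasure_lborel_box_finite in auto)
    then have "integrable lborel (\<lambda>x. indicator (box u v) x * (f1 (x$1) * f2 (x$2) * cos (c - t * sin (x$3))))"
    proof (rule integrable_mult_bounded)
      show "(\<lambda>x::real^3. f1 (x$1) * f2 (x$2) * cos (c - t * sin (x$3))) \<in> borel_measurable lborel"
        using that by measurable
      show "\<bar>f1 (x$1) * f2 (x$2) * cos (c - t * sin (x$3))\<bar> \<le> 1" for x :: "real^3"
        unfolding abs_mult using that by (intro mult_le_one) auto
    qed
    then show ?thesis unfolding box by (simp add: mult_ac)
  qed
  let ?C = "\<lambda>x. cos (a * x)" and ?S = "\<lambda>x. sin (a * x)"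
    and ?C' = "\<lambda>x. cos (b * x + c)" and ?S' = "\<lambda>x. sin (b * x + c)"
  \<comment> \<open>The sine of \<open>t * sin (x$3)\<close> is the cosine of
    \<open>pi/2 - t * sin (x$3)\<close>, so offsets 0 and \<open>pi/2\<close> bring all four terms
    under the same one-dimensional lemma. The original \<open>c\<close> is absorbed into the second
    factor.\<close>
  have eq: "indicator (box u v) x * osc a b c t x =
      ?p ?C ?C' 0 t x - ?p ?S ?S' 0 t x + ?p ?S ?C' (pi/2) t x + ?p ?C ?S' (pi/2) t x" for t x
  proof -
    have "cos (A + B - C) = cos A * cos B * cos C - sin A * sin B * cos C + sin A * cos B * sin C
        + cos A * sin B * sin C" for A B C :: real
      by (simp add: cos_diff cos_add sin_add algebra_simps)
    from this[of "a * x$1" "b * x$2 + c" "t * sin (x$3)"]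
    have o: "osc a b c t x = ?C (x$1) * ?C' (x$2) * cos (t * sin (x$3)) - ?S (x$1) * ?S' (x$2) * cos (t * sin (x$3))
        + ?S (x$1) * ?C' (x$2) * sin (t * sin (x$3)) + ?C (x$1) * ?S' (x$2) * sin (t * sin (x$3))"
      by (simp add: osc_def add.assoc)
    show ?thesis
      unfolding box o by (simp add: cos_diff algebra_simps)
  qed
  have m: "?C \<in> borel_measurable borel" "?S \<in> borel_measurable borel"
    "?C' \<in> borel_measurable borel" "?S' \<in> borel_measurable borel" by measurable
  have int: "integrable lborel (?p ?C ?C' c' t)" "integrable lborel (?p ?S ?S' c' t)"
    "integrable lborel (?p ?S ?C' c' t)" "integrable lborel (?p ?C ?S' c' t)" for c' t
    using m by (auto intro!: p_integrable)
  have lim: "((\<lambda>t. \<integral>x. ?p ?C ?C' c' t x \<partial>lborel) \<longlongrightarrow> 0) at_top" "((\<lambda>t. \<integral>x. ?p ?S ?S' c' t x \<partial>lborel) \<longlongrightarrow> 0) at_top"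
    "((\<lambda>t. \<integral>x. ?p ?S ?C' c' t x \<partial>lborel) \<longlongrightarrow> 0) at_top" "((\<lambda>t. \<integral>x. ?p ?C ?S' c' t x \<partial>lborel) \<longlongrightarrow> 0) at_top" for c'
    using m by (auto intro!: p_lim)
  have "(\<integral>x. indicator (box u v) x * osc a b c t x \<partial>lborel) =
      (\<integral>x. ?p ?C ?C' 0 t x \<partial>lborel) - (\<integral>x. ?p ?S ?S' 0 t x \<partial>lborel) +
      (\<integral>x. ?p ?S ?C' (pi/2) t x \<partial>lborel) + (\<integral>x. ?p ?C ?S' (pi/2) t x \<partial>lborel)" for t
    by (simp only: eq int Bochner_Integration.integral_add Bochner_Integration.integral_diff
        Bochner_Integration.integrable_add Bochner_Integration.integrable_diff)
  moreover have "((\<lambda>t. (\<integral>x. ?p ?C ?C' 0 t x \<partial>lborel) - (\<integral>x. ?p ?S ?S' 0 t x \<partial>lborel) +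
      (\<integral>x. ?p ?S ?C' (pi/2) t x \<partial>lborel) + (\<integral>x. ?p ?C ?S' (pi/2) t x \<partial>lborel)) \<longlongrightarrow> 0 - 0 + 0 + 0) at_top"
    by (intro tendsto_add tendsto_diff lim)
  ultimately show ?thesis by simp
qed

text \<open>Test functions on the torus are only Lebesgue measurable, whereas the density argument
  lives on Borel measure. Extension by zero followed by an almost everywhere equal Borel function
  \<open>g\<close> bridges the two without changing any integral.\<close>

lemma tendsto_integral_osc_cell:
  assumes h: "integrable (lebesgue_on torus_cell) h"
  shows "((\<lambda>t. \<integral>x. h x * osc a b c t x \<partial>lebesgue_on torus_cell) \<longlongrightarrow> 0) at_top"
proof -
  let ?h = "\<lambda>x. indicator torus_cell x * h x"
  have cell: "torus_cell \<in> sets lebesgue" by (simp add: torus_cell_def)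
  have hi: "integrable lebesgue ?h" using h cell by (simp add: integrable_restrict_space)
  obtain g where g: "g \<in> borel_measurable lborel" "AE x in lborel. ?h x = g x"
    using completion_ex_borel_measurable_real[OF borel_measurable_integrable[OF hi]] by blast
  have g': "g \<in> borel_measurable lebesgue" using g(1) by (rule measurable_completion)
  have ae: "AE x in lebesgue. ?h x = g x" using g(2) by (rule AE_completion)
  have "integrable lebesgue g"
    using integrable_cong_AE_imp[OF hi g'] ae by auto
  then have gi: "integrable lborel g" using integrable_completion[OF g(1)] by simp
  have "(\<integral>x. h x * osc a b c t x \<partial>lebesgue_on torus_cell) = (\<integral>x. g x * osc a b c t x \<partial>lborel)" for t
  proof -
    have o: "osc a b c t \<in> borel_measurable lebesgue" by (rule measurable_completion) simp
    have "(\<integral>x. h x * osc a b c t x \<partial>lebesgue_on torus_cell) = (\<integral>x. ?h x * osc a b c t x \<partial>lebesgue)"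
      using cell by (simp add: integral_restrict_space mult.assoc)
    also have "\<dots> = (\<integral>x. g x * osc a b c t x \<partial>lebesgue)"
    proof (rule integral_cong_AE)
      show "(\<lambda>x. ?h x * osc a b c t x) \<in> borel_measurable lebesgue"
        using borel_measurable_integrable[OF hi] o by (rule borel_measurable_times)
      show "(\<lambda>x. g x * osc a b c t x) \<in> borel_measurable lebesgue"
        using g' o by (rule borel_measurable_times)
      show "AE x in lebesgue. ?h x * osc a b c t x = g x * osc a b c t x"
        using ae by eventually_elim simp
    qed
    also have "\<dots> = (\<integral>x. g x * osc a b c t x \<partial>lborel)"
      using g(1) by (intro integral_completion) simp
    finally show ?thesis .
  qed
  moreover have "((\<lambda>t. \<integral>x. g x * osc a b c t x \<partial>lborel) \<longlongrightarrow> 0) at_top"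
    by (rule tendsto_integral_zero_from_boxes[OF _ _ tendsto_integral_osc_box gi])
       (auto simp: osc_measurable, simp add: osc_def)
  ultimately show ?thesis by simp
qed

section \<open>The Euler flow\<close>

lemma has_derivative_sin_inner:
  fixes k :: "'a::real_inner" and w :: "'b::real_normed_vector"
  shows "((\<lambda>x. sin (k \<bullet> x + c) *\<^sub>R w) has_derivative
    (\<lambda>v. sin (k \<bullet> x + (c + pi / 2)) *\<^sub>R ((k \<bullet> v) *\<^sub>R w))) (at x)"
proof -
  have "sin (k \<bullet> x + (c + pi / 2)) = cos (k \<bullet> x + c)"
    using sin_add[of "k \<bullet> x + c" "pi/2"] by (simp add: add.assoc)
  then show ?thesis
    by (auto intro!: derivative_eq_intros simp: fun_eq_iff)
qed

text \<open>Writing the cosine as a sine shifted by \<open>pi / 2\<close> makes every directional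
  derivative a function of the same shape, with new \<open>c\<close> and \<open>w\<close>. Hence the
  induction is generalised over both.\<close>

lemma Ck_sin_inner: "Ck n (\<lambda>x::'a::real_inner. sin (k \<bullet> x + c) *\<^sub>R w)"
proof (induction n arbitrary: c w)
  case 0
  show ?case by (auto intro!: continuous_intros)
next
  case (Suc n)
  have "frechet_derivative (\<lambda>x. sin (k \<bullet> x + c) *\<^sub>R w) (at x) =
      (\<lambda>v. sin (k \<bullet> x + (c + pi / 2)) *\<^sub>R ((k \<bullet> v) *\<^sub>R w))" for x
    using frechet_derivative_at[OF has_derivative_sin_inner] by (rule sym)
  then show ?case
    using has_derivative_sin_inner[of k c w] Suc.IH by (auto simp: differentiable_def simp del: scaleR_scaleR)
qed

lemma Ck_add: "Ck n f \<Longrightarrow> Ck n g \<Longrightarrow> Ck n (\<lambda>x. f x + g x)"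
proof (induction n arbitrary: f g)
  case 0
  then show ?case by (auto intro!: continuous_intros)
next
  case (Suc n)
  have "frechet_derivative (\<lambda>x. f x + g x) (at x) =
      (\<lambda>v. frechet_derivative f (at x) v + frechet_derivative g (at x) v)" for x
    using Suc.prems
    by (intro frechet_derivative_at[symmetric] has_derivative_add)
       (auto simp: frechet_derivative_works[symmetric])
  then show ?case using Suc by auto
qed

section \<open>Explicit derivatives and the Euler equations\<close>

definition phase :: "int \<Rightarrow> real \<Rightarrow> real^3 \<Rightarrow> real" where
  "phase l t x = of_int l * x$1 + x$2 - t * sin (x$3)"

text \<open>This direction is orthogonal to the spatial gradient of the phase, so the oscillating
  part is divergence-free and does not transport its own phase.\<close>

definition osc_dir :: "int \<Rightarrow> real^3" where
  "osc_dir l = vector [1, - of_int l, 0]"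

lemma osc_dir_nth [simp]: "osc_dir l $ 1 = 1" "osc_dir l $ 2 = - of_int l" "osc_dir l $ 3 = 0"
  by (simp_all add: osc_dir_def)

lemma uE_eq: "uE l t x = sin (phase l t x) *\<^sub>R osc_dir l + sin (x$3) *\<^sub>R axis 2 1"
  by (simp add: uE_def phase_def osc_dir_def vec_eq_iff forall_3 axis_def)

lemma uK_eq: "uK x = sin (x$3) *\<^sub>R axis 2 1"
  by (simp add: uK_def vec_eq_iff forall_3 axis_def)

lemma uE_minus_uK: "uE l t x - uK x = sin (phase l t x) *\<^sub>R osc_dir l"
  by (simp add: uE_eq uK_eq)

lemma sin_periodic_int: "sin (x + of_int n * (2 * pi)) = sin x"
proof -
  have "sin (x + of_int n * (2 * pi)) = sin x * cos (2 * pi * of_int n) + cos x * sin (2 * pi * of_int n)"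
    by (simp add: sin_add mult.commute mult.left_commute)
  then show ?thesis by simp
qed

lemma sin_phase_periodic: "sin (phase l t (x + axis i (2 * pi))) = sin (phase l t x)"
proof -
  have "i = 1 \<or> i = 2 \<or> i = 3" using exhaust_3[of i] .
  then show ?thesis
  proof (elim disjE)
    \<comment> \<open>Here integrality of \<open>l\<close> matters: the phase changes by an integer
      multiple of the period.\<close>
    assume "i = 1"
    then have "phase l t (x + axis i (2 * pi)) = phase l t x + of_int l * (2 * pi)"
      by (simp add: phase_def axis_def algebra_simps)
    then show ?thesis by (simp only: sin_periodic_int)
  next
    assume "i = 2"
    then have "phase l t (x + axis i (2 * pi)) = phase l t x + 2 * pi"
      by (simp add: phase_def axis_def algebra_simps)
    then show ?thesis by simp
  next
    assume "i = 3"
    then show ?thesis by (simp add: phase_def axis_def)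
  qed
qed

lemma torus_periodic_uK: "torus_periodic uK"
  by (auto simp: torus_periodic_def uK_eq axis_def)

lemma torus_periodic_uE: "torus_periodic (uE l t)"
  unfolding torus_periodic_def uE_eq sin_phase_periodic by (auto simp: axis_def)

lemma has_derivative_uE:
  "(uE l t has_derivative (\<lambda>h. (cos (phase l t x) * (of_int l * h$1 + h$2 - t * (cos (x$3) * h$3))) *\<^sub>R osc_dir l +
      (cos (x$3) * h$3) *\<^sub>R axis 2 1)) (at x)"
  unfolding uE_eq[abs_def] phase_def
  by (auto intro!: derivative_eq_intros bounded_linear_imp_has_derivative[OF bounded_linear_vec_nth]
      simp: fun_eq_iff algebra_simps)

lemma partial_deriv_uE:
  "partial_deriv 1 (uE l t) x = (cos (phase l t x) * of_int l) *\<^sub>R osc_dir l"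
  "partial_deriv 2 (uE l t) x = cos (phase l t x) *\<^sub>R osc_dir l"
  "partial_deriv 3 (uE l t) x = (- cos (phase l t x) * t * cos (x$3)) *\<^sub>R osc_dir l + cos (x$3) *\<^sub>R axis 2 1"
  unfolding partial_deriv_def frechet_derivative_at[OF has_derivative_uE, symmetric]
  by (simp_all add: axis_def)

lemma has_vector_derivative_uE:
  "((\<lambda>s. uE l s x) has_vector_derivative (- sin (x$3) * cos (phase l t x)) *\<^sub>R osc_dir l) (at t within S)"
  unfolding uE_eq phase_def
  by (auto intro!: derivative_eq_intros simp: has_vector_derivative_def fun_eq_iff algebra_simps)

lemma time_deriv_uE:
  assumes "t \<ge> 0"
  shows "time_deriv (uE l) t x = (- sin (x$3) * cos (phase l t x)) *\<^sub>R osc_dir l"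
proof -
  \<comment> \<open>At \<open>t = 0\<close> only the one-sided derivative exists in
    \<open>time_deriv\<close>; it is unique because the filter is nontrivial.\<close>
  have "at_right t \<le> at t within {0..}" using assms by (intro at_le) auto
  then have "at t within {0..} \<noteq> bot" using trivial_limit_at_right_real[of t] by (auto simp: bot_unique)
  then show ?thesis
    unfolding time_deriv_def by (rule vector_derivative_within[OF _ has_vector_derivative_uE])
qed

lemma divergence_uE: "divergence (uE l t) x = 0"
  by (simp add: divergence_def sum_3 partial_deriv_uE axis_def)

text \<open>The third velocity component vanishes, so the derivative in \<open>x$3\<close> with its
  factor \<open>t\<close> never enters. The oscillating terms cancel by orthogonality, leaving the
  transport of the phase by \<open>sin (x$3)\<close>, which is exactly minus the time
  derivative.\<close>

lemma advection_uE: "advection (uE l t) (uE l t) x = (sin (x$3) * cos (phase l t x)) *\<^sub>R osc_dir l"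
  by (simp add: advection_def sum_3 partial_deriv_uE vec_eq_iff uE_eq forall_3 axis_def algebra_simps)

lemma continuous_on_phase [continuous_intros]:
  fixes S :: "'a::t2_space set"
  assumes "continuous_on S f" "continuous_on S g"
  shows "continuous_on S (\<lambda>y. phase l (f y) (g y))"
  unfolding phase_def using assms by (intro continuous_intros)

lemma C1_spacetime_uE: "C1_spacetime (uE l)"
proof -
  have "(\<lambda>s. uE l s x) differentiable (at t within {0..})" for t x
    using has_vector_derivative_uE[of l x t "{0..}"] by (rule differentiableI_vector)
  moreover have "uE l t differentiable (at x)" for t x
    using has_derivative_uE by (auto simp: differentiable_def)
  moreover have "continuous_on S (\<lambda>(t, x). uE l t x)" for S
    unfolding uE_eq by (auto intro!: continuous_intros simp: case_prod_unfold)
  \<comment> \<open>The formula for \<open>time_deriv\<close> is available only for nonnegative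
    times, so continuity is transferred from the explicit expression on that set.\<close>
  moreover have "continuous_on ({0..} \<times> UNIV) (\<lambda>(t, x). time_deriv (uE l) t x)"
  proof -
    have "continuous_on ({0..} \<times> UNIV) (\<lambda>p. (- sin (snd p$3) * cos (phase l (fst p) (snd p))) *\<^sub>R osc_dir l)"
      by (intro continuous_intros)
    then show ?thesis
      by (rule continuous_on_eq) (auto simp: time_deriv_uE)
  qed
  moreover have "continuous_on S (\<lambda>(t, x). partial_deriv i (uE l t) x)" for i S
    using exhaust_3[of i]
    by (auto intro!: continuous_intros simp: case_prod_unfold partial_deriv_uE)
  ultimately show ?thesis unfolding C1_spacetime_def by auto
qed

lemma global_euler_solution_uE: "global_euler_solution (uE l)"
proof -
  have "partial_deriv i (\<lambda>_. 0 :: real) x = 0" for i x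
    by (simp add: partial_deriv_def frechet_derivative_const)
  then have g: "grad (\<lambda>_. 0) x = 0" for x
    by (simp add: grad_def vec_eq_iff)
  show ?thesis
    unfolding global_euler_solution_def
  proof (intro conjI exI[of _ "\<lambda>_ _. 0"])
    show "\<forall>t\<ge>0. \<forall>x. time_deriv (uE l) t x + advection (uE l t) (uE l t) x + grad (\<lambda>_. 0) x = 0 \<and>
        divergence (uE l t) x = 0"
      by (simp add: g time_deriv_uE advection_uE divergence_uE scaleR_left.minus)
  qed (auto simp: C1_spacetime_uE torus_periodic_uE g case_prod_unfold torus_periodic_def[of "\<lambda>_. 0"])
qed

section \<open>Weak and strong convergence in L2\<close>

lemma continuous_on_imp_integrable_cell:
  fixes f :: "real^3 \<Rightarrow> 'b::euclidean_space"
  assumes "continuous_on torus_cell f"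
  shows "integrable (lebesgue_on torus_cell) f"
  using absolutely_integrable_continuous[of 0 _ f] assms
  by (simp add: torus_cell_def set_integrable_def integrable_restrict_space)

lemma continuous_on_imp_L2_torus:
  assumes "continuous_on UNIV f" "torus_periodic f"
  shows "f \<in> L2_torus"
proof -
  have "continuous_on torus_cell f" using assms(1) by (rule continuous_on_subset) simp
  then show ?thesis
    using assms(2) continuous_on_imp_integrable_cell[of f]
    by (auto simp: L2_torus_def borel_measurable_integrable
        intro!: continuous_on_imp_integrable_cell continuous_intros)
qed

lemma continuous_on_uE: "continuous_on S (uE l t)"
  unfolding uE_eq[abs_def] by (intro continuous_intros)

lemma continuous_on_uK: "continuous_on S uK"
  unfolding uK_eq[abs_def] by (intro continuous_intros)

lemma uE_in_L2_torus: "uE l t \<in> L2_torus"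
  by (intro continuous_on_imp_L2_torus continuous_on_uE torus_periodic_uE)

lemma uK_in_L2_torus: "uK \<in> L2_torus"
  by (intro continuous_on_imp_L2_torus continuous_on_uK torus_periodic_uK)

text \<open>Nonintegrable functions have Bochner integral 0 by convention, so subtracting two values
  of \<open>L2_inner\<close> under one integral requires this.\<close>

lemma L2_torus_inner_integrable:
  assumes "f \<in> L2_torus" "g \<in> L2_torus"
  shows "integrable (lebesgue_on torus_cell) (\<lambda>x. f x \<bullet> g x)"
proof (rule Bochner_Integration.integrable_bound)
  show "integrable (lebesgue_on torus_cell) (\<lambda>x. (norm (f x))\<^sup>2 + (norm (g x))\<^sup>2)"
    using assms by (auto simp: L2_torus_def)
  have "f \<in> borel_measurable (lebesgue_on torus_cell)" "g \<in> borel_measurable (lebesgue_on torus_cell)"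
    using assms by (auto simp: L2_torus_def)
  then show "(\<lambda>x. f x \<bullet> g x) \<in> borel_measurable (lebesgue_on torus_cell)" by (rule borel_measurable_inner)
  have "\<bar>f x \<bullet> g x\<bar> \<le> (norm (f x))\<^sup>2 + (norm (g x))\<^sup>2" for x
  proof -
    have "\<bar>f x \<bullet> g x\<bar> \<le> norm (f x) * norm (g x)" by (rule Cauchy_Schwarz_ineq2)
    also have "\<dots> \<le> 2 * norm (f x) * norm (g x)" by simp
    also have "\<dots> \<le> (norm (f x))\<^sup>2 + (norm (g x))\<^sup>2" by (rule sum_squares_bound)
    finally show ?thesis .
  qed
  then show "AE x in lebesgue_on torus_cell. norm (f x \<bullet> g x) \<le> norm ((norm (f x))\<^sup>2 + (norm (g x))\<^sup>2)"
    by simp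
qed

lemma weakly_converges_uE: "weakly_converges_L2 (uE l) uK at_top"
  unfolding weakly_converges_L2_def
proof
  fix g assume g: "g \<in> L2_torus"
  let ?h = "\<lambda>x. osc_dir l \<bullet> g x"
  \<comment> \<open>The constant field is square integrable on the cell, so its pairing with
    \<open>g\<close> is an admissible test function for the Riemann-Lebesgue lemma.\<close>
  have "(\<lambda>_. osc_dir l) \<in> L2_torus"
    by (rule continuous_on_imp_L2_torus) (auto simp: torus_periodic_def)
  then have h: "integrable (lebesgue_on torus_cell) ?h"
    using g by (rule L2_torus_inner_integrable)
  have "L2_inner (uE l t) g = L2_inner uK g + (\<integral>x. ?h x * osc (of_int l) 1 (- (pi / 2)) t x \<partial>lebesgue_on torus_cell)" for t
  proof -
    \<comment> \<open>The offset \<open>- (pi / 2)\<close> turns the cosine in \<open>osc\<close>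
      into the sine of the phase.\<close>
    have o: "osc (of_int l) 1 (- (pi / 2)) t x = sin (phase l t x)" for x
      using cos_diff[of "phase l t x" "pi / 2"] by (simp add: osc_def phase_def algebra_simps)
    have "L2_inner (uE l t) g - L2_inner uK g = (\<integral>x. uE l t x \<bullet> g x - uK x \<bullet> g x \<partial>lebesgue_on torus_cell)"
      using g by (simp add: L2_inner_def L2_torus_inner_integrable uE_in_L2_torus uK_in_L2_torus)
    also have "\<dots> = (\<integral>x. ?h x * osc (of_int l) 1 (- (pi / 2)) t x \<partial>lebesgue_on torus_cell)"
      by (simp add: o inner_diff_left[symmetric] uE_minus_uK mult.commute)
    finally show ?thesis by simp
  qed
  then show "((\<lambda>t. L2_inner (uE l t) g) \<longlongrightarrow> L2_inner uK g) at_top"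
    using tendsto_add[OF tendsto_const tendsto_integral_osc_cell[OF h]] by simp
qed

lemma not_strongly_converges_uE: "\<not> strongly_converges_L2 (uE l) uK at_top"
proof
  assume "strongly_converges_L2 (uE l) uK at_top"
  then have zero: "((\<lambda>t. (L2_norm (\<lambda>x. uE l t x - uK x))\<^sup>2) \<longlongrightarrow> 0\<^sup>2) at_top"
    unfolding strongly_converges_L2_def by (rule tendsto_power)
  \<comment> \<open>The half comes from expressing the squared sine through the cosine of the
    doubled phase. The squared distance then tends to \<open>K\<close> times the volume of the
    cell.\<close>
  define K where "K = osc_dir l \<bullet> osc_dir l / 2"
  let ?M = "lebesgue_on torus_cell"
  let ?J = "\<lambda>t. \<integral>x. 1 * osc (2 * of_int l) 2 0 t x \<partial>?M"
  have const: "integrable ?M (\<lambda>_. c :: real)" for c by (rule continuous_on_imp_integrable_cell) simp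
  have norm: "(L2_norm (\<lambda>x. uE l t x - uK x))\<^sup>2 = K * (measure ?M torus_cell - ?J (2 * t))" for t
  proof -
    have i: "integrable ?M (\<lambda>x. 1 * osc (2 * of_int l) 2 0 (2 * t) x)"
      by (rule continuous_on_imp_integrable_cell) (auto simp: osc_def intro!: continuous_intros)
    \<comment> \<open>Doubling the phase doubles the time as well, so the limit of \<open>?J\<close>
      is used along \<open>2 * t\<close>.\<close>
    have o: "osc (2 * of_int l) 2 0 (2 * t) x = cos (2 * phase l t x)" for x
      by (simp add: osc_def phase_def algebra_simps)
    have "(L2_norm (\<lambda>x. uE l t x - uK x))\<^sup>2 = L2_inner (\<lambda>x. uE l t x - uK x) (\<lambda>x. uE l t x - uK x)"
      unfolding L2_norm_def by (intro real_sqrt_pow2) (simp add: L2_inner_def)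
    also have "\<dots> = (\<integral>x. K * (1 - 1 * osc (2 * of_int l) 2 0 (2 * t) x) \<partial>?M)"
      unfolding L2_inner_def uE_minus_uK o
      by (intro Bochner_Integration.integral_cong)
         (auto simp: K_def cos_double_sin power2_eq_square)
    also have "\<dots> = K * (\<integral>x. 1 - 1 * osc (2 * of_int l) 2 0 (2 * t) x \<partial>?M)" by simp
    also have "(\<integral>x. 1 - 1 * osc (2 * of_int l) 2 0 (2 * t) x \<partial>?M) = (\<integral>x. 1 \<partial>?M) - ?J (2 * t)"
      using i const by (intro Bochner_Integration.integral_diff) auto
    also have "(\<integral>x. 1 \<partial>?M) = measure ?M torus_cell" by simp
    finally show ?thesis .
  qed
  have "((\<lambda>t. ?J (2 * t)) \<longlongrightarrow> 0) at_top"
    by (rule filterlim_compose[OF tendsto_integral_osc_cell[OF const]])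
       (rule filterlim_tendsto_pos_mult_at_top[OF tendsto_const _ filterlim_ident], simp)
  then have "((\<lambda>t. K * (measure ?M torus_cell - ?J (2 * t))) \<longlongrightarrow> K * (measure ?M torus_cell - 0)) at_top"
    by (intro tendsto_intros)
  \<comment> \<open>Strong convergence would give the same squared norms the limit 0, forcing
    \<open>K\<close> times the volume to vanish, although both factors are positive.\<close>
  from tendsto_unique[OF trivial_limit_at_top_linorder this zero[unfolded norm]]
  have "K * (measure ?M torus_cell) = 0" by simp
  moreover have "osc_dir l \<noteq> 0" using osc_dir_nth(1)[of l] by (metis zero_index zero_neq_one)
  then have "K > 0" by (simp add: K_def)
  moreover have "measure ?M torus_cell > 0"
    by (simp add: torus_cell_def measure_restrict_space content_pos_lt_eq Basis_vec_def inner_axis)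
  ultimately show False by simp
qed

theorem mainTheorem4:
  fixes l :: int and u0 :: "real^3 \<Rightarrow> real^3"
  defines "u0 \<equiv> \<lambda>x. vector
     [sin (of_int l * x$1 + x$2),
      - of_int l * sin (of_int l * x$1 + x$2) + sin (x$3),
      0]"
  shows "global_euler_solution (uE l) \<and>
         uE l 0 = u0 \<and> torus_periodic u0 \<and> smooth u0 \<and>
         (\<forall>t\<ge>0. uE l t \<in> L2_torus) \<and> uK \<in> L2_torus \<and>
         weakly_converges_L2 (uE l) uK at_top \<and>
         \<not> strongly_converges_L2 (uE l) uK at_top"
proof -
  have u0: "uE l 0 = u0" by (simp add: uE_def u0_def fun_eq_iff)
  let ?k = "vector [of_int l, 1, 0] :: real^3"
  \<comment> \<open>At time 0 the phase is linear in \<open>x\<close>, so the initial datum is a sum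
    of two plane waves.\<close>
  have "uE l 0 = (\<lambda>x. sin (?k \<bullet> x + 0) *\<^sub>R osc_dir l + sin (axis 3 1 \<bullet> x + 0) *\<^sub>R axis 2 1)"
    unfolding uE_eq[abs_def] by (simp add: phase_def inner_vec_def sum_3 axis_def)
  then have "smooth (uE l 0)"
    unfolding smooth_def by (simp only:) (intro allI Ck_add Ck_sin_inner)
  then show ?thesis
    using u0 global_euler_solution_uE torus_periodic_uE[of l 0] uE_in_L2_torus uK_in_L2_torus
      weakly_converges_uE not_strongly_converges_uE by simp
qed

end
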